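(* Let $K\subseteq\mathbb{R}^d$ be a set and let $C\subseteq\mathbb{R}^d$ be a compact convex set with $0\in\operatorname{int}(C)$. Then the following numbers (in $\overline{\mathbb{R}}$) are equal: (a) $\sup\{\gamma_C(x-y) : x,y\in K\}$, (b) $\sup\{w_K(u) : u\in C^\circ\}$, (c) $\sup\{\langle u, x\rangle : u\in C^\circ,\ x\in K-K\}$. If, in addition, $K$ is non-empty, closed and convex, then the following number is also equal to the numbers above: (d) $\sup\left\{\dfrac{l_K(u)}{r_C(u)} : u\in\mathbb{R}^d\setminus\{0\}\right\}$.
   Context: $\langle\cdot,\cdot\rangle$ is the standard inner product on $\mathbb{R}^d$, $\overline{\mathbb{R}}=\mathbb{R}\cup\{+\infty,-\infty\}$, and $K-K=\{x-y : x,y\in K\}$. Suprema are taken in $\overline{\mathbb{R}}$, so a supremum over the empty set is $-\infty$, except where stated otherwise below. Minkowski functional: $\gamma_C(x)=\inf\{\lambda>0 : x\in\lambda C\}$. Support function: $h_K(x)=\sup\{\langle x,y\rangle : y\in K\}\in\overline{\mathbb{R}}$. Width function: $w_K(x)=h_K(x)+h_K(-x)$. Polar set: $C^\circ=\{x\in\mathbb{R}^d : h_C(x)\le 1\}$. Maximal chord-length function: $l_K(x)=\sup\{\alpha>0 : \alpha x\in K-K\}$. Radius function: $r_C(u)=\sup\{\alpha>0 : \alpha u\in C\}$. In the definitions of $l_K$ and $r_C$, the supremum of the empty set is $0$. *)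

theory Defs
  imports "HOL-Analysis.Analysis"
begin

text \<open>All functionals take values in \<^typ>\<open>ereal\<close>, where \<open>Sup {} = -\<infinity>\<close> and \<open>Inf {} = \<infinity>\<close>.\<close>

definition minkowski_functional :: "'a::euclidean_space set \<Rightarrow> 'a \<Rightarrow> ereal" where
  "minkowski_functional C x = Inf {ereal t | t. t > 0 \<and> x \<in> (\<lambda>z. t *\<^sub>R z) ` C}"

definition support_fun :: "'a::euclidean_space set \<Rightarrow> 'a \<Rightarrow> ereal" where
  "support_fun K x = Sup {ereal (x \<bullet> y) | y. y \<in> K}"

text \<open>The sum is never of the form \<open>\<infinity> + (-\<infinity>)\<close>: both summands are \<open>-\<infinity>\<close> if \<open>K\<close> is empty,
  and neither is otherwise.\<close>

definition width_fun :: "'a::euclidean_space set \<Rightarrow> 'a \<Rightarrow> ereal" where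
  "width_fun K x = support_fun K x + support_fun K (- x)"

definition polar_set :: "'a::euclidean_space set \<Rightarrow> 'a set" where
  "polar_set C = {x. support_fun C x \<le> 1}"

text \<open>The set \<open>K - K\<close> of differences of elements; the library's minus on sets is the
  set-theoretic difference.\<close>

definition difference_set :: "'a::euclidean_space set \<Rightarrow> 'a set" where
  "difference_set K = {x - y | x y. x \<in> K \<and> y \<in> K}"

text \<open>Supremum with the convention that the empty set has supremum \<open>0\<close>.\<close>

definition Sup0 :: "ereal set \<Rightarrow> ereal" where
  "Sup0 A = (if A = {} then 0 else Sup A)"

definition max_chord_length :: "'a::euclidean_space set \<Rightarrow> 'a \<Rightarrow> ereal" where
  "max_chord_length K x = Sup0 {ereal t | t. t > 0 \<and> t *\<^sub>R x \<in> difference_set K}"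

definition radius_fun :: "'a::euclidean_space set \<Rightarrow> 'a \<Rightarrow> ereal" where
  "radius_fun C u = Sup0 {ereal t | t. t > 0 \<and> t *\<^sub>R u \<in> C}"

end

theory Submission
  imports Defs
begin

text \<open>Separating \<open>x\<close> from \<open>t C\<close> shows that \<open>\<gamma>\<^sub>C\<close> is the support function of \<open>C\<^sup>\<circ>\<close>, and taking
  suprema over the two points of \<open>K\<close> separately gives \<open>w\<^sub>K = h\<^bsub>K-K\<^esub>\<close>. So (a), (b) and (c) are
  iterated suprema of \<open>\<langle>u, x - y\<rangle>\<close> in different orders. For (d), \<open>1 / r\<^sub>C(u) = \<gamma>\<^sub>C(u)\<close> for
  \<open>u \<noteq> 0\<close>, so \<open>l\<^sub>K(u) / r\<^sub>C(u)\<close> is the supremum of \<open>\<gamma>\<^sub>C\<close> over the part of \<open>K - K\<close> on the ray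
  through \<open>u\<close>.\<close>

lemma polar_set_iff: "u \<in> polar_set C \<longleftrightarrow> (\<forall>z\<in>C. u \<bullet> z \<le> 1)"
  by (auto simp: polar_set_def support_fun_def Sup_le_iff one_ereal_def)

lemma zero_in_polar_set: "0 \<in> polar_set C"
  by (simp add: polar_set_iff)

lemma inner_le_minkowski_functional:
  assumes "u \<in> polar_set C"
  shows "ereal (u \<bullet> x) \<le> minkowski_functional C x"
  unfolding minkowski_functional_def
proof (rule Inf_greatest)
  fix s assume "s \<in> {ereal t |t. t > 0 \<and> x \<in> (\<lambda>z. t *\<^sub>R z) ` C}"
  then obtain t z where t: "s = ereal t" "t > 0" "x = t *\<^sub>R z" "z \<in> C" by auto
  have "u \<bullet> z \<le> 1" using assms t by (simp add: polar_set_iff)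
  then have "t * (u \<bullet> z) \<le> t" using \<open>t > 0\<close> by simp
  then show "ereal (u \<bullet> x) \<le> s" using t by simp
qed

text \<open>This is the nontrivial half of the bipolar theorem in contrapositive form: a hyperplane
  strictly separating \<open>y\<close> from \<open>C\<close>, suitably rescaled, is a polar
  vector.\<close>

lemma exists_polar_inner_gt:
  fixes C :: "'a::euclidean_space set"
  assumes "closed C" "convex C" "0 \<in> C" "y \<notin> C"
  obtains u where "u \<in> polar_set C" "u \<bullet> y > 1"
proof -
  obtain a b where ab: "a \<bullet> y < b" "\<forall>z\<in>C. a \<bullet> z > b"
    using separating_hyperplane_closed_point[OF assms(2,1,4)] by blast
  \<comment> \<open>Since \<open>b\<close> is negative, dividing by it reverses both inequalities
    and normalises the threshold to 1.\<close>
  with \<open>0 \<in> C\<close> have "b < 0" by fastforce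
  show ?thesis
  proof
    show "(a /\<^sub>R b) \<in> polar_set C"
      using ab(2) \<open>b < 0\<close> by (auto simp: polar_set_iff field_simps less_imp_le)
    show "(a /\<^sub>R b) \<bullet> y > 1"
      using ab(1) \<open>b < 0\<close> by (simp add: field_simps)
  qed
qed

text \<open>The bound from above rests on separation: if \<open>t\<close> exceeds the supremum and
  \<open>x /\<^sub>R t\<close> were outside \<open>C\<close>, some polar \<open>u\<close> would give
  \<open>u \<bullet> x > t\<close>.\<close>

lemma minkowski_functional_eq_Sup_polar:
  fixes C :: "'a::euclidean_space set"
  assumes "closed C" "convex C" "0 \<in> C"
  shows "minkowski_functional C x = Sup {ereal (u \<bullet> x) |u. u \<in> polar_set C}"
    (is "_ = ?S")
proof (rule antisym)
  show "?S \<le> minkowski_functional C x"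
    by (auto intro!: Sup_least inner_le_minkowski_functional)
  \<comment> \<open>The polar vector 0 gives this; it makes every \<open>t > s\<close> below
    positive, so that \<open>x\<close> can be divided by \<open>t\<close>.\<close>
  have nonneg: "0 \<le> ?S"
    by (rule Sup_upper) (use zero_in_polar_set in \<open>force simp: zero_ereal_def\<close>)
  show "minkowski_functional C x \<le> ?S"
  proof (rule ereal_le_real)
    fix s assume s: "?S \<le> ereal s"
    have le: "minkowski_functional C x \<le> ereal t" if "t > s" for t
    proof -
      have "t > 0" using nonneg order_trans[OF nonneg s] that by simp
      have "x /\<^sub>R t \<in> C"
      proof (rule ccontr)
        assume "x /\<^sub>R t \<notin> C"
        then obtain u where u: "u \<in> polar_set C" "u \<bullet> (x /\<^sub>R t) > 1"
          using exists_polar_inner_gt[OF assms] by blast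
        have "ereal (u \<bullet> x) \<le> ?S" using u(1) by (auto intro: Sup_upper)
        then have "u \<bullet> x \<le> s" using order_trans s by fastforce
        moreover have "u \<bullet> x > t" using u(2) \<open>t > 0\<close> by (simp add: field_simps)
        ultimately show False using that by simp
      qed
      then have "x \<in> (\<lambda>z. t *\<^sub>R z) ` C"
        using \<open>t > 0\<close> by (force intro: image_eqI[of _ _ "x /\<^sub>R t"])
      then show ?thesis
        using \<open>t > 0\<close> unfolding minkowski_functional_def by (auto intro: Inf_lower)
    qed
    show "minkowski_functional C x \<le> ereal s"
    \<comment> \<open>The bound \<open>s\<close> may itself be 0, hence the detour through
      \<open>t = s + e\<close>.\<close>
    proof (rule ereal_le_epsilon2)
      fix e :: real assume "0 < e"
      then show "minkowski_functional C x \<le> ereal s + ereal e" using le[of "s + e"] by simp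
    qed
  qed
qed

text \<open>The two suprema in the width range over independent points of \<open>K\<close>, so their
  sum is one supremum over pairs. For empty \<open>K\<close> both sides are -\<infinity>.\<close>

lemma width_fun_eq_Sup_difference_set:
  "width_fun K u = Sup {ereal (u \<bullet> x) |x. x \<in> difference_set K}"
proof (cases "K = {}")
  case True
  then show ?thesis
    by (simp add: width_fun_def support_fun_def difference_set_def bot_ereal_def)
next
  case False
  have supp: "support_fun K v = (SUP y\<in>K. ereal (v \<bullet> y))" for v
    unfolding support_fun_def by (rule arg_cong[of _ _ Sup]) auto
  \<comment> \<open>Moving a summand into a supremum requires a non-empty index set and a summand
    other than -\<infinity>.\<close>
  have ninf: "support_fun K v \<noteq> - \<infinity>" for v
  proof -
    obtain y where "y \<in> K" using False by blast
    then have "ereal (v \<bullet> y) \<le> support_fun K v" unfolding supp by (rule SUP_upper)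
    then show ?thesis by auto
  qed
  have "width_fun K u = (SUP x\<in>K. ereal (u \<bullet> x) + support_fun K (- u))"
    unfolding width_fun_def
    by (subst supp) (rule SUP_ereal_add_left[OF False ninf, symmetric])
  also have "\<dots> = (SUP x\<in>K. SUP y\<in>K. ereal (u \<bullet> x) + ereal (- u \<bullet> y))"
    by (intro SUP_cong refl, subst supp) (rule SUP_ereal_add_right[symmetric], use False in auto)
  also have "\<dots> = Sup {ereal (u \<bullet> x) |x. x \<in> difference_set K}"
  proof (rule antisym)
    show "(SUP x\<in>K. SUP y\<in>K. ereal (u \<bullet> x) + ereal (- u \<bullet> y))
        \<le> Sup {ereal (u \<bullet> x) |x. x \<in> difference_set K}"
      by (intro SUP_least Sup_upper) (auto simp: difference_set_def simp flip: inner_diff_right)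
    show "Sup {ereal (u \<bullet> x) |x. x \<in> difference_set K}
        \<le> (SUP x\<in>K. SUP y\<in>K. ereal (u \<bullet> x) + ereal (- u \<bullet> y))"
    proof (rule Sup_least, clarsimp simp: difference_set_def)
      fix x y assume "x \<in> K" "y \<in> K"
      then show "ereal (u \<bullet> (x - y)) \<le> (SUP x\<in>K. SUP y\<in>K. ereal (u \<bullet> x - u \<bullet> y))"
        by (intro SUP_upper2[of x] SUP_upper2[of y]) (auto simp: inner_diff_right)
    qed
  qed
  finally show ?thesis .
qed

text \<open>\<open>C\<close> contains a ball around 0 and lies in a larger one, so the radius is
  positive and finite. The third fact records that the default value of \<open>Sup0\<close> does not
  occur.\<close>

lemma radius_fun_real:
  fixes C :: "'a::euclidean_space set"
  assumes "bounded C" "0 \<in> interior C" "u \<noteq> 0"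
  obtains r where "r > 0" "radius_fun C u = ereal r"
    "radius_fun C u = Sup {ereal t |t. t > 0 \<and> t *\<^sub>R u \<in> C}"
proof -
  let ?A = "{ereal t |t. t > 0 \<and> t *\<^sub>R u \<in> C}"
  obtain e where e: "e > 0" "cball 0 e \<subseteq> C"
    using assms(2) by (auto simp: mem_interior_cball)
  obtain B where B: "\<And>z. z \<in> C \<Longrightarrow> norm z \<le> B"
    using assms(1) by (auto simp: bounded_iff)
  \<comment> \<open>This factor scales \<open>u\<close> to the boundary of the ball inside
    \<open>C\<close>.\<close>
  let ?t = "e / norm u"
  have "?t > 0" using e assms(3) by simp
  have "?t *\<^sub>R u \<in> cball 0 e" using e assms(3) by simp
  then have mem: "ereal ?t \<in> ?A" using e \<open>?t > 0\<close> by blast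
  have rad: "radius_fun C u = Sup ?A"
    unfolding radius_fun_def Sup0_def using mem by (metis empty_iff)
  have low: "ereal ?t \<le> Sup ?A" using mem by (rule Sup_upper)
  have upp: "Sup ?A \<le> ereal (B / norm u)"
  proof (rule Sup_least, clarsimp)
    fix t :: real assume "t > 0" "t *\<^sub>R u \<in> C"
    then have "t * norm u \<le> B" using B[of "t *\<^sub>R u"] by simp
    then show "t \<le> B / norm u" using assms(3) by (simp add: field_simps)
  qed
  obtain r where "Sup ?A = ereal r" using low upp by (cases "Sup ?A") auto
  then show ?thesis using that rad low \<open>?t > 0\<close> by auto
qed

text \<open>If \<open>t *\<^sub>R u = s *\<^sub>R z\<close> with \<open>z\<close> in
  \<open>C\<close>, then \<open>t / s\<close> is an admissible factor for the radius, so
  \<open>t / s \<le> r\<close>.\<close>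

lemma divide_radius_le_minkowski_functional:
  fixes C :: "'a::euclidean_space set"
  assumes "bounded C" "0 \<in> interior C" "u \<noteq> 0" "t > 0"
  shows "ereal t / radius_fun C u \<le> minkowski_functional C (t *\<^sub>R u)"
  unfolding minkowski_functional_def
proof (rule Inf_greatest, clarsimp)
  fix s z assume s: "t *\<^sub>R u = s *\<^sub>R z" "s > 0" "z \<in> C"
  obtain r where r: "r > 0" "radius_fun C u = ereal r"
    "radius_fun C u = Sup {ereal t |t. t > 0 \<and> t *\<^sub>R u \<in> C}"
    using radius_fun_real[OF assms(1-3)] .
  have "z = (1 / s) *\<^sub>R (t *\<^sub>R u)"
    unfolding s(1) using s(2) by simp
  then have "z = (t / s) *\<^sub>R u" by simp
  then have "ereal (t / s) \<le> ereal r"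
    using s \<open>t > 0\<close> unfolding r(2)[symmetric] r(3) by (auto intro!: Sup_upper)
  then show "ereal t / radius_fun C u \<le> ereal s"
    using r s by (simp add: field_simps)
qed

text \<open>When \<open>v \<bullet> u\<close> is positive, its inverse bounds every factor
  \<open>t\<close> that keeps \<open>t *\<^sub>R u\<close> in \<open>C\<close>, and hence the
  radius; otherwise the left side is at most 0.\<close>

lemma inner_polar_le_inverse_radius:
  fixes C :: "'a::euclidean_space set"
  assumes "bounded C" "0 \<in> interior C" "u \<noteq> 0" "v \<in> polar_set C"
  shows "ereal (v \<bullet> u) \<le> 1 / radius_fun C u"
proof -
  obtain r where r: "r > 0" "radius_fun C u = ereal r"
    "radius_fun C u = Sup {ereal t |t. t > 0 \<and> t *\<^sub>R u \<in> C}"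
    using radius_fun_real[OF assms(1-3)] .
  have "r * (v \<bullet> u) \<le> 1"
  proof (cases "v \<bullet> u > 0")
    case True
    have "ereal r \<le> ereal (1 / (v \<bullet> u))"
      unfolding r(2)[symmetric] r(3)
    proof (rule Sup_least, clarsimp)
      fix t :: real assume "t > 0" "t *\<^sub>R u \<in> C"
      then have "v \<bullet> (t *\<^sub>R u) \<le> 1" using assms(4) unfolding polar_set_iff by blast
      then show "t \<le> 1 / (v \<bullet> u)" using True by (simp add: field_simps)
    qed
    then show ?thesis using True by (simp add: field_simps)
  next
    case False
    then have "r * (v \<bullet> u) \<le> 0" using r(1) by (simp add: mult_nonneg_nonpos)
    then show ?thesis by simp
  qed
  then show ?thesis using r by (simp add: field_simps one_ereal_def)
qed

lemma max_chord_length_nonneg: "0 \<le> max_chord_length K u"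
  unfolding max_chord_length_def Sup0_def
  by (auto intro: Sup_upper2 simp del: Collect_empty_eq)

lemma one_le_max_chord_length:
  assumes "u \<in> difference_set K"
  shows "1 \<le> max_chord_length K u"
proof -
  have mem: "ereal 1 \<in> {ereal t |t. t > 0 \<and> t *\<^sub>R u \<in> difference_set K}"
    using assms by force
  then have "max_chord_length K u = Sup {ereal t |t. t > 0 \<and> t *\<^sub>R u \<in> difference_set K}"
    unfolding max_chord_length_def Sup0_def by (metis empty_iff)
  then show ?thesis using Sup_upper[OF mem] by (simp add: one_ereal_def)
qed

text \<open>A nonzero difference \<open>x\<close> is tested in its own direction
  \<open>u = x\<close>, where the chord length is at least 1. Conversely, each
  \<open>t *\<^sub>R u\<close> in the difference set satisfies \<open>t / r \<le> ?M\<close>, and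
  the supremum over \<open>t\<close> gives the ratio.\<close>

lemma Sup_polar_difference_eq_Sup_chord_ratio:
  fixes K C :: "'a::euclidean_space set"
  assumes "compact C" "convex C" "0 \<in> interior C" "K \<noteq> {}"
  shows "Sup {ereal (u \<bullet> x) |u x. u \<in> polar_set C \<and> x \<in> difference_set K}
       = Sup {max_chord_length K u / radius_fun C u |u. u \<noteq> 0}"
    (is "?M = ?R")
proof (rule antisym)
  have bdd: "bounded C" and clo: "closed C"
    using assms(1) by (simp_all add: compact_imp_bounded compact_imp_closed)
  have zero: "0 \<in> C" using assms(3) interior_subset by blast
  have ratio_nonneg: "0 \<le> max_chord_length K u / radius_fun C u" if "u \<noteq> 0" for u
    using max_chord_length_nonneg[of K u] radius_fun_real[OF bdd assms(3) that]
    by (metis ereal_less(2) less_imp_le zero_le_divide_ereal)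
  have mink_le: "minkowski_functional C x \<le> ?M" if "x \<in> difference_set K" for x
    unfolding minkowski_functional_eq_Sup_polar[OF clo assms(2) zero]
    using that by (intro Sup_subset_mono) blast
  show "?M \<le> ?R"
  proof (rule Sup_least, clarify)
    fix v x assume v: "v \<in> polar_set C" and x: "x \<in> difference_set K"
    show "ereal (v \<bullet> x) \<le> ?R"
    proof (cases "x = 0")
      case True
      \<comment> \<open>The point 0 has no direction of its own, but the ratio in any direction is
        at least 0.\<close>
      obtain b :: 'a where "b \<noteq> 0" using nonzero_Basis SOME_Basis by blast
      then have "0 \<le> max_chord_length K b / radius_fun C b" by (rule ratio_nonneg)
      also have "\<dots> \<le> ?R" using \<open>b \<noteq> 0\<close> by (intro Sup_upper) blast
      finally show ?thesis using True by (simp add: zero_ereal_def)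
    next
      case False
      obtain r where r: "r > 0" "radius_fun C x = ereal r"
        using radius_fun_real[OF bdd assms(3) False] .
      have "ereal (v \<bullet> x) \<le> 1 / radius_fun C x"
        by (rule inner_polar_le_inverse_radius[OF bdd assms(3) False v])
      also have "\<dots> \<le> max_chord_length K x / radius_fun C x"
        using one_le_max_chord_length[OF x] r by (intro ereal_divide_right_mono) auto
      also have "\<dots> \<le> ?R" using False by (intro Sup_upper) blast
      finally show ?thesis .
    qed
  qed
  show "?R \<le> ?M"
  proof (rule Sup_least, clarify)
    fix u :: 'a assume "u \<noteq> 0"
    obtain r where r: "r > 0" "radius_fun C u = ereal r"
      using radius_fun_real[OF bdd assms(3) \<open>u \<noteq> 0\<close>] .
    \<comment> \<open>This covers directions with no chord, where \<open>Sup0\<close> returns 0; it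
      is where \<open>K\<close> must be non-empty.\<close>
    have "0 \<le> ?M"
    proof (rule Sup_upper)
      obtain k where "k \<in> K" using assms(4) by blast
      then have "k - k \<in> difference_set K" unfolding difference_set_def by blast
      then show "0 \<in> {ereal (u \<bullet> x) |u x. u \<in> polar_set C \<and> x \<in> difference_set K}"
        using zero_in_polar_set[of C] by (force simp: zero_ereal_def)
    qed
    \<comment> \<open>Clearing the denominator makes the right side an upper bound for all
      \<open>t\<close> at once, even if \<open>?M\<close> is infinite.\<close>
    moreover have "ereal t \<le> ereal r * ?M" if "t > 0" "t *\<^sub>R u \<in> difference_set K" for t
    proof -
      have "ereal t / ereal r \<le> ?M"
        using divide_radius_le_minkowski_functional[OF bdd assms(3) \<open>u \<noteq> 0\<close> that(1)]
          mink_le[OF that(2)] r(2) by simp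
      then show ?thesis using r(1) by (subst (asm) ereal_divide_le_pos) auto
    qed
    ultimately have "max_chord_length K u \<le> ereal r * ?M"
      using r(1) unfolding max_chord_length_def Sup0_def by (auto intro!: Sup_least)
    then show "max_chord_length K u / radius_fun C u \<le> ?M"
      using r by (simp add: ereal_divide_le_pos)
  qed
qed

theorem theorem3p12:
  fixes K C :: "'a::euclidean_space set"
  assumes "compact C" and "convex C" and "0 \<in> interior C"
  shows "Sup {minkowski_functional C (x - y) | x y. x \<in> K \<and> y \<in> K}
           = Sup {width_fun K u | u. u \<in> polar_set C}
       \<and> Sup {width_fun K u | u. u \<in> polar_set C}
           = Sup {ereal (u \<bullet> x) | u x. u \<in> polar_set C \<and> x \<in> difference_set K}
       \<and> (K \<noteq> {} \<and> closed K \<and> convex K \<longrightarrow>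
            Sup {ereal (u \<bullet> x) | u x. u \<in> polar_set C \<and> x \<in> difference_set K}
              = Sup {max_chord_length K u / radius_fun C u | u. u \<noteq> 0})"
proof -
  let ?M = "Sup {ereal (u \<bullet> x) | u x. u \<in> polar_set C \<and> x \<in> difference_set K}"
  have clo: "closed C" using assms(1) by (rule compact_imp_closed)
  have zero: "0 \<in> C" using assms(3) interior_subset by blast
  \<comment> \<open>Here the difference is fixed first and the inner supremum runs over the polar
    set.\<close>
  have a: "Sup {minkowski_functional C (x - y) | x y. x \<in> K \<and> y \<in> K} = ?M" (is "?A = _")
  proof (rule antisym)
    show "?A \<le> ?M"
    proof (rule Sup_least, clarify)
      fix x y assume "x \<in> K" "y \<in> K"
      then have "x - y \<in> difference_set K" unfolding difference_set_def by blast
      then show "minkowski_functional C (x - y) \<le> ?M"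
        unfolding minkowski_functional_eq_Sup_polar[OF clo assms(2) zero]
        by (intro Sup_subset_mono) blast
    qed
    show "?M \<le> ?A"
      unfolding difference_set_def
      by (rule Sup_mono) (use inner_le_minkowski_functional in blast)
  qed
  \<comment> \<open>The order is now reversed: \<open>u\<close> is fixed and the inner supremum runs
    over the differences.\<close>
  have b: "Sup {width_fun K u | u. u \<in> polar_set C} = ?M" (is "?B = _")
  proof (rule antisym)
    show "?B \<le> ?M"
    proof (rule Sup_least, clarify)
      fix u assume "u \<in> polar_set C"
      then show "width_fun K u \<le> ?M"
        unfolding width_fun_eq_Sup_difference_set by (intro Sup_subset_mono) blast
    qed
    show "?M \<le> ?B"
    proof (rule Sup_mono, clarify)
      fix u x assume "u \<in> polar_set C" "x \<in> difference_set K"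
      moreover from this have "ereal (u \<bullet> x) \<le> width_fun K u"
        unfolding width_fun_eq_Sup_difference_set by (intro Sup_upper) blast
      ultimately show "\<exists>w\<in>{width_fun K u |u. u \<in> polar_set C}. ereal (u \<bullet> x) \<le> w"
        by blast
    qed
  qed
  show ?thesis
    using a b Sup_polar_difference_eq_Sup_chord_ratio[OF assms] by simp
qed

end
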